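(* Let $(\mathcal S,\mathcal T)$ be a token system. Then $(\mathcal S,\mathcal T)$ is a medium if and only if the following four conditions hold: [M1] Any token has a reverse. [M2] For any two distinct states $S,V$ in $\mathcal S$ there is a consistent message transforming $S$ into $V$. [M3] A message which is stepwise effective for some state is ineffective for that state if and only if it is vacuous. [M4] Two stepwise effective, consistent messages producing the same state (that is, $\boldsymbol m$ stepwise effective for $S$ and $\boldsymbol n$ stepwise effective for $W$ with $S\boldsymbol m=W\boldsymbol n$, for some states $S,W$) are jointly consistent.
   Context: No set is assumed to be finite. Token systems. Let $\mathcal S$ be a set of states with $|\mathcal S|\ge 2$. A token is a function $\tau:\mathcal S\to\mathcal S$, written $S\mapsto S\tau$, different from the identity function $\tau_0$ on $\mathcal S$; compositions are written $S\tau_1\tau_2\cdots\tau_n=\tau_n[\cdots\tau_2[\tau_1(S)]\cdots]$. A token system is a pair $(\mathcal S,\mathcal T)$ with $\mathcal T\ne\emptyset$ a set of tokens on $\mathcal S$. For distinct states $S,V$, $V$ is adjacent to $S$ if $S\tau=V$ for some $\tau\in\mathcal T$. A token $\tilde\tau\in\mathcal T$ is a reverse of a token $\tau$ if for any two adjacent states $S,V$ (distinct states, one of which is adjacent to the other) we have $S\tau=V\iff V\tilde\tau=S$. A token has at most one reverse. Messages. A message is a string $\boldsymbol m=\tau_1\ldots\tau_n$ of tokens of $\mathcal T$; it defines the function $S\mapsto S\boldsymbol m=S\tau_1\cdots\tau_n$, and produces $V$ from $S$ (transforms $S$ into $V$) if $S\boldsymbol m=V$. It is ineffective for $S$ if $S\boldsymbol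 m=S$; stepwise effective for $S$ if $S\tau_1\cdots\tau_k\ne S\tau_0\cdots\tau_{k-1}$ for $1\le k\le n$; a return (for $S$) if it is both stepwise effective and ineffective for $S$; consistent if it does not contain both a token and its reverse; concise for $S$ if it is consistent, stepwise effective for $S$, and no token occurs in it more than once; vacuous if $\{1,\ldots,n\}$ can be partitioned into pairs $\{i,j\}$ such that $\tau_i,\tau_j$ are mutual reverses. Two messages $\boldsymbol m,\boldsymbol n$ are jointly consistent if the concatenation $\boldsymbol m\boldsymbol n$ is consistent. A token system $(\mathcal S,\mathcal T)$ is a medium if: [Ma] for any two distinct states $S,V$ there is a concise message producing $V$ from $S$; [Mb] any return message is vacuous. *)

theory Defs
  imports "HOL-Library.FuncSet" "HOL-Library.Disjoint_Sets"
begin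

(* Functions on the state set are taken to be extensional (undefined outside the state set),
   so that HOL equality of tokens is equality of functions on that set. *)

definition is_token :: "'s set \<Rightarrow> ('s \<Rightarrow> 's) \<Rightarrow> bool" where
  "is_token \<S> \<tau> \<longleftrightarrow> \<tau> \<in> \<S> \<rightarrow>\<^sub>E \<S> \<and> \<tau> \<noteq> (\<lambda>S\<in>\<S>. S)"

(* The cardinality condition is not phrased with card, since the state set may be infinite. *)

definition token_system :: "'s set \<Rightarrow> ('s \<Rightarrow> 's) set \<Rightarrow> bool" where
  "token_system \<S> \<T> \<longleftrightarrow>
     (\<exists>S\<in>\<S>. \<exists>V\<in>\<S>. S \<noteq> V) \<and> \<T> \<noteq> {} \<and> (\<forall>\<tau>\<in>\<T>. is_token \<S> \<tau>)"

definition adjacent_to :: "'s set \<Rightarrow> ('s \<Rightarrow> 's) set \<Rightarrow> 's \<Rightarrow> 's \<Rightarrow> bool" where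
  "adjacent_to \<S> \<T> V S \<longleftrightarrow> S \<in> \<S> \<and> V \<in> \<S> \<and> S \<noteq> V \<and> (\<exists>\<tau>\<in>\<T>. \<tau> S = V)"

definition adjacent_states :: "'s set \<Rightarrow> ('s \<Rightarrow> 's) set \<Rightarrow> 's \<Rightarrow> 's \<Rightarrow> bool" where
  "adjacent_states \<S> \<T> S V \<longleftrightarrow> adjacent_to \<S> \<T> V S \<or> adjacent_to \<S> \<T> S V"

definition is_reverse :: "'s set \<Rightarrow> ('s \<Rightarrow> 's) set \<Rightarrow> ('s \<Rightarrow> 's) \<Rightarrow> ('s \<Rightarrow> 's) \<Rightarrow> bool" where
  "is_reverse \<S> \<T> \<tau>' \<tau> \<longleftrightarrow>
     \<tau>' \<in> \<T> \<and> (\<forall>S V. adjacent_states \<S> \<T> S V \<longrightarrow> (\<tau> S = V \<longleftrightarrow> \<tau>' V = S))"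

definition mutual_reverses :: "'s set \<Rightarrow> ('s \<Rightarrow> 's) set \<Rightarrow> ('s \<Rightarrow> 's) \<Rightarrow> ('s \<Rightarrow> 's) \<Rightarrow> bool" where
  "mutual_reverses \<S> \<T> \<sigma> \<tau> \<longleftrightarrow> is_reverse \<S> \<T> \<sigma> \<tau> \<and> is_reverse \<S> \<T> \<tau> \<sigma>"

(* Messages are the elements of lists \<T>. The leftmost token acts first. *)

definition transform :: "('s \<Rightarrow> 's) list \<Rightarrow> 's \<Rightarrow> 's" where
  "transform m S = foldl (\<lambda>V \<tau>. \<tau> V) S m"

definition ineffective :: "('s \<Rightarrow> 's) list \<Rightarrow> 's \<Rightarrow> bool" where
  "ineffective m S \<longleftrightarrow> transform m S = S"

definition stepwise_effective :: "('s \<Rightarrow> 's) list \<Rightarrow> 's \<Rightarrow> bool" where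
  "stepwise_effective m S \<longleftrightarrow>
     (\<forall>k\<in>{1..length m}. transform (take k m) S \<noteq> transform (take (k - 1) m) S)"

definition return_for :: "('s \<Rightarrow> 's) list \<Rightarrow> 's \<Rightarrow> bool" where
  "return_for m S \<longleftrightarrow> stepwise_effective m S \<and> ineffective m S"

(* \<sigma> and \<tau> are not required to be distinct: a token that is its own reverse occurs in no
   consistent message. *)

definition consistent :: "'s set \<Rightarrow> ('s \<Rightarrow> 's) set \<Rightarrow> ('s \<Rightarrow> 's) list \<Rightarrow> bool" where
  "consistent \<S> \<T> m \<longleftrightarrow> \<not> (\<exists>\<sigma>\<in>set m. \<exists>\<tau>\<in>set m. is_reverse \<S> \<T> \<sigma> \<tau>)"

definition jointly_consistent ::
    "'s set \<Rightarrow> ('s \<Rightarrow> 's) set \<Rightarrow> ('s \<Rightarrow> 's) list \<Rightarrow> ('s \<Rightarrow> 's) list \<Rightarrow> bool" where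
  "jointly_consistent \<S> \<T> m n \<longleftrightarrow> consistent \<S> \<T> (m @ n)"

definition concise :: "'s set \<Rightarrow> ('s \<Rightarrow> 's) set \<Rightarrow> ('s \<Rightarrow> 's) list \<Rightarrow> 's \<Rightarrow> bool" where
  "concise \<S> \<T> m S \<longleftrightarrow> consistent \<S> \<T> m \<and> stepwise_effective m S \<and> distinct m"

definition vacuous :: "'s set \<Rightarrow> ('s \<Rightarrow> 's) set \<Rightarrow> ('s \<Rightarrow> 's) list \<Rightarrow> bool" where
  "vacuous \<S> \<T> m \<longleftrightarrow>
     (\<exists>P. partition_on {..<length m} P \<and>
          (\<forall>p\<in>P. \<exists>i j. i \<noteq> j \<and> p = {i, j} \<and> mutual_reverses \<S> \<T> (m ! i) (m ! j)))"

definition medium :: "'s set \<Rightarrow> ('s \<Rightarrow> 's) set \<Rightarrow> bool" where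
  "medium \<S> \<T> \<longleftrightarrow>
     token_system \<S> \<T> \<and>
     (\<forall>S\<in>\<S>. \<forall>V\<in>\<S>. S \<noteq> V \<longrightarrow>
        (\<exists>m\<in>lists \<T>. concise \<S> \<T> m S \<and> transform m S = V)) \<and>
     (\<forall>m\<in>lists \<T>. \<forall>S\<in>\<S>. return_for m S \<longrightarrow> vacuous \<S> \<T> m)"

end

theory Submission
  imports Defs
begin

text \<open>In a medium, closing a stepwise effective message by a concise message back to its initial
  state gives a return, hence a vacuous message, in which a token and its reverse occur equally
  often. A vacuous stepwise effective message that is not ineffective would leave the concise part
  alone with equally many occurrences of a token and its reverse, and a violation of [M4] would,
  after inverting one of the two messages, give a message with two occurrences of some token and
  none of its reverse, which no concise message can compensate. Conversely, if a token \<open>\<tau>\<close> occurred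
  twice in a stepwise effective consistent message, then the part before the second \<open>\<tau>\<close> and the
  one-token message consisting of the reverse of \<open>\<tau>\<close> would produce the same state, against [M4].\<close>

section \<open>Messages acting on states\<close>

lemma transform_Nil [simp]: "transform [] S = S"
  by (simp add: transform_def)

lemma transform_Cons [simp]: "transform (\<tau> # m) S = transform m (\<tau> S)"
  by (simp add: transform_def)

lemma transform_append [simp]: "transform (m @ n) S = transform n (transform m S)"
  by (simp add: transform_def)

lemma stepwise_effective_Nil [simp]: "stepwise_effective [] S"
  by (simp add: stepwise_effective_def)

text \<open>Shifting the index down by one removes the subtraction, so that the condition unfolds
  along the list.\<close>

lemma stepwise_effective_iff_nth:
  "stepwise_effective m S \<longleftrightarrow>
     (\<forall>k<length m. transform (take (Suc k) m) S \<noteq> transform (take k m) S)"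
proof -
  have "{1..length m} = Suc ` {..<length m}"
    by (simp add: image_Suc_lessThan)
  then show ?thesis
    by (auto simp: stepwise_effective_def)
qed

lemma stepwise_effective_Cons [simp]:
  "stepwise_effective (\<tau> # m) S \<longleftrightarrow> \<tau> S \<noteq> S \<and> stepwise_effective m (\<tau> S)"
  by (auto simp: stepwise_effective_iff_nth All_less_Suc2)

lemma stepwise_effective_append [simp]:
  "stepwise_effective (m @ n) S \<longleftrightarrow>
     stepwise_effective m S \<and> stepwise_effective n (transform m S)"
  by (induction m arbitrary: S) auto

lemma distinct_count_list: "distinct xs \<Longrightarrow> count_list xs x \<le> 1"
  by (induction xs) auto

lemma consistent_mono: "consistent \<S> \<T> m \<Longrightarrow> set n \<subseteq> set m \<Longrightarrow> consistent \<S> \<T> n"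
  unfolding consistent_def by blast

lemma stepwise_effective_reduct:
  "\<exists>n. set n \<subseteq> set m \<and> stepwise_effective n S \<and> transform n S = transform m S"
proof (induction m arbitrary: S)
  case Nil
  show ?case by (rule exI[of _ "[]"]) simp
next
  case (Cons \<tau> m)
  obtain n where n: "set n \<subseteq> set m" "stepwise_effective n (\<tau> S)"
    "transform n (\<tau> S) = transform m (\<tau> S)"
    using Cons.IH by blast
  show ?case
  proof (cases "\<tau> S = S")
    case True
    with n show ?thesis by (intro exI[of _ n]) auto
  next
    case False
    with n show ?thesis by (intro exI[of _ "\<tau> # n"]) auto
  qed
qed

section \<open>Reverses and vacuous messages\<close>

lemma is_reverse_iff:
  "is_reverse \<S> \<T> \<tau>' \<tau> \<Longrightarrow> adjacent_states \<S> \<T> S V \<Longrightarrow> \<tau> S = V \<longleftrightarrow> \<tau>' V = S"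
  unfolding is_reverse_def by simp

text \<open>Adjacency is symmetric, so exchanging the two states exchanges the two tokens.\<close>

lemma is_reverse_sym: "is_reverse \<S> \<T> \<sigma> \<tau> \<Longrightarrow> \<tau> \<in> \<T> \<Longrightarrow> is_reverse \<S> \<T> \<tau> \<sigma>"
  unfolding is_reverse_def adjacent_states_def by metis

lemma vacuous_has_reverse:
  assumes "vacuous \<S> \<T> m" and "\<tau> \<in> set m"
  shows "\<exists>\<tau>'. is_reverse \<S> \<T> \<tau>' \<tau>"
proof -
  obtain P where P: "partition_on {..<length m} P"
    and pair: "\<And>p. p \<in> P \<Longrightarrow> \<exists>i j. i \<noteq> j \<and> p = {i, j} \<and> mutual_reverses \<S> \<T> (m ! i) (m ! j)"
    using assms(1) unfolding vacuous_def by blast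
  obtain k where k: "k < length m" "m ! k = \<tau>"
    using assms(2) by (auto simp: in_set_conv_nth)
  obtain p where "p \<in> P" "k \<in> p"
    using k(1) partition_onD1[OF P] by blast
  with pair[of p] k(2) show ?thesis
    unfolding mutual_reverses_def by auto
qed

section \<open>Reverses within a fixed token system\<close>

locale tokens =
  fixes \<S> :: "'s set" and \<T> :: "('s \<Rightarrow> 's) set"
  assumes token_system: "token_system \<S> \<T>"
begin

lemma token_closed: "\<tau> \<in> \<T> \<Longrightarrow> S \<in> \<S> \<Longrightarrow> \<tau> S \<in> \<S>"
  using token_system unfolding token_system_def is_token_def by (meson PiE_mem)

lemma token_extensional: "\<tau> \<in> \<T> \<Longrightarrow> \<tau> \<in> extensional \<S>"
  using token_system unfolding token_system_def is_token_def by (simp add: PiE_def)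

lemma token_moves_state:
  assumes "\<tau> \<in> \<T>"
  obtains S where "S \<in> \<S>" "\<tau> S \<noteq> S"
proof -
  have "\<tau> \<noteq> (\<lambda>S\<in>\<S>. S)"
    using assms token_system unfolding token_system_def is_token_def by blast
  \<comment> \<open>By extensionality, a token fixing every state would be the restricted
    identity.\<close>
  then show ?thesis
    using that extensionalityI[of \<tau> \<S> "\<lambda>S\<in>\<S>. S"] token_extensional[OF assms]
    by (metis restrict_apply' restrict_extensional)
qed

lemma transform_closed: "m \<in> lists \<T> \<Longrightarrow> S \<in> \<S> \<Longrightarrow> transform m S \<in> \<S>"
  by (induction m arbitrary: S) (auto simp: token_closed)

lemma reverse_step:
  assumes "is_reverse \<S> \<T> \<tau>' \<tau>" "\<tau> \<in> \<T>" "S \<in> \<S>" "\<tau> S \<noteq> S"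
  shows "\<tau>' (\<tau> S) = S"
proof -
  have "adjacent_states \<S> \<T> S (\<tau> S)"
    using assms(2-) token_closed[of \<tau> S]
    unfolding adjacent_states_def adjacent_to_def by auto
  from is_reverse_iff[OF assms(1) this] show ?thesis by simp
qed

text \<open>If one reverse moves \<open>V\<close> to \<open>U\<close>, then \<open>U\<close> and
  \<open>V\<close> are adjacent, so \<open>\<tau>\<close> takes \<open>U\<close> to \<open>V\<close>
  and any other reverse also takes \<open>V\<close> to \<open>U\<close>. Where neither moves the
  state, both fix it.\<close>

lemma reverse_unique:
  assumes "is_reverse \<S> \<T> \<sigma> \<tau>" "is_reverse \<S> \<T> \<rho> \<tau>"
  shows "\<sigma> = \<rho>"
proof -
  have *: "\<beta> V = \<alpha> V"
    if "is_reverse \<S> \<T> \<alpha> \<tau>" "is_reverse \<S> \<T> \<beta> \<tau>" "V \<in> \<S>" "\<alpha> V \<noteq> V" for \<alpha> \<beta> V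
  proof -
    have "\<alpha> \<in> \<T>" using that(1) unfolding is_reverse_def by blast
    then have adj: "adjacent_states \<S> \<T> (\<alpha> V) V"
      using that(3,4) token_closed[of \<alpha> V]
      unfolding adjacent_states_def adjacent_to_def by auto
    show ?thesis
      using is_reverse_iff[OF that(1) adj] is_reverse_iff[OF that(2) adj] by simp
  qed
  have "\<sigma> \<in> \<T>" "\<rho> \<in> \<T>" using assms unfolding is_reverse_def by auto
  then show ?thesis
    using *[OF assms] *[OF assms(2,1)] token_extensional
    by (intro extensionalityI[of _ \<S>]) metis+
qed

text \<open>Every step moves its state, so the reverses applied in the opposite order retrace the
  path. The last clause restricts which tokens the way back can contain.\<close>

lemma inverse_message:
  assumes rev: "\<And>\<tau>. \<tau> \<in> \<T> \<Longrightarrow> \<exists>\<tau>'. is_reverse \<S> \<T> \<tau>' \<tau>"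
    and "m \<in> lists \<T>" "S \<in> \<S>" "stepwise_effective m S"
  shows "\<exists>n\<in>lists \<T>. stepwise_effective n (transform m S) \<and> transform n (transform m S) = S \<and>
           (\<forall>\<sigma>\<in>set n. \<exists>\<rho>\<in>set m. is_reverse \<S> \<T> \<sigma> \<rho>)"
  using assms(2-)
proof (induction m arbitrary: S rule: list.induct)
  case Nil
  show ?case by (rule bexI[of _ "[]"]) auto
next
  case (Cons \<tau> m)
  have \<tau>: "\<tau> \<in> \<T>" "\<tau> S \<noteq> S" "\<tau> S \<in> \<S>"
    using Cons.prems token_closed by auto
  obtain n where n: "n \<in> lists \<T>" "stepwise_effective n (transform m (\<tau> S))"
    "transform n (transform m (\<tau> S)) = \<tau> S" "\<forall>\<sigma>\<in>set n. \<exists>\<rho>\<in>set m. is_reverse \<S> \<T> \<sigma> \<rho>"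
    using Cons.IH[of "\<tau> S"] Cons.prems \<tau> by auto
  obtain \<tau>' where \<tau>': "is_reverse \<S> \<T> \<tau>' \<tau>"
    using rev \<tau>(1) by blast
  have "\<tau>' (\<tau> S) = S"
    using reverse_step \<tau>' \<tau> Cons.prems(2) by blast
  moreover have "\<tau>' \<in> \<T>" using \<tau>' unfolding is_reverse_def by blast
  ultimately show ?case
    using n \<tau>' \<tau>(2) by (intro bexI[of _ "n @ [\<tau>']"]) auto
qed

text \<open>Each pair of the partition contributes equally to both counts.\<close>

lemma vacuous_count_reverse:
  assumes vac: "vacuous \<S> \<T> m" and rev: "is_reverse \<S> \<T> \<tau>' \<tau>" and \<tau>: "\<tau> \<in> \<T>"
  shows "count_list m \<tau> = count_list m \<tau>'"
proof -
  obtain P where P: "partition_on {..<length m} P"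
    and pair: "\<And>p. p \<in> P \<Longrightarrow> \<exists>i j. i \<noteq> j \<and> p = {i, j} \<and> mutual_reverses \<S> \<T> (m ! i) (m ! j)"
    using vac unfolding vacuous_def by blast
  have fin: "finite P" using finite_elements[OF _ P] by simp
  have finp: "finite p" if "p \<in> P" for p using pair[OF that] by auto
  have count: "count_list m \<sigma> = (\<Sum>p\<in>P. card {i\<in>p. m ! i = \<sigma>})" for \<sigma>
  proof -
    have "count_list m \<sigma> = card {i. i < length m \<and> m ! i = \<sigma>}"
      by (simp add: count_list_eq_length_filter length_filter_conv_card eq_commute)
    also have "{i. i < length m \<and> m ! i = \<sigma>} = (\<Union>p\<in>P. {i\<in>p. m ! i = \<sigma>})"
      using partition_onD1[OF P] by auto
    also have "card \<dots> = (\<Sum>p\<in>P. card {i\<in>p. m ! i = \<sigma>})"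
      using fin finp partition_onD2[OF P]
      by (intro card_UN_disjoint) (auto simp: disjoint_def)
    finally show ?thesis .
  qed
  have rev': "is_reverse \<S> \<T> \<tau> \<tau>'" using is_reverse_sym[OF rev \<tau>] .
  have "card {i\<in>p. m ! i = \<tau>} = card {i\<in>p. m ! i = \<tau>'}" if p: "p \<in> P" for p
  proof -
    obtain i j where ij: "i \<noteq> j" "p = {i, j}" "mutual_reverses \<S> \<T> (m ! i) (m ! j)"
      using pair[OF p] by blast
    \<comment> \<open>Reverses are unique, so a position holding \<open>\<tau>\<close> can only be
      paired with one holding \<open>\<tau>'\<close>, and conversely.\<close>
    have swap: "m ! k = \<tau> \<longleftrightarrow> m ! l = \<tau>'" if "mutual_reverses \<S> \<T> (m ! k) (m ! l)" for k l
      using that rev rev' reverse_unique unfolding mutual_reverses_def by metis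
    have "m ! i = \<tau> \<longleftrightarrow> m ! j = \<tau>'" "m ! j = \<tau> \<longleftrightarrow> m ! i = \<tau>'"
      using swap ij(3) unfolding mutual_reverses_def by auto
    then have "bij_betw (\<lambda>k. if k = i then j else i) {k\<in>p. m ! k = \<tau>} {k\<in>p. m ! k = \<tau>'}"
      using ij(1,2) by (auto simp: bij_betw_def inj_on_def image_iff)
    then show ?thesis by (rule bij_betw_same_card)
  qed
  then show ?thesis unfolding count by (rule sum.cong[OF refl])
qed

section \<open>Properties of media\<close>

text \<open>[Ma] supplies the way back, and [Mb] applies to the resulting closed path. If the
  message already returns to \<open>S\<close>, the empty message serves.\<close>

lemma medium_closing:
  assumes med: "medium \<S> \<T>" and m: "m \<in> lists \<T>" "S \<in> \<S>" "stepwise_effective m S"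
  obtains n where "n \<in> lists \<T>" "concise \<S> \<T> n (transform m S)"
    "transform n (transform m S) = S" "vacuous \<S> \<T> (m @ n)"
proof -
  have "\<exists>n\<in>lists \<T>. concise \<S> \<T> n (transform m S) \<and> transform n (transform m S) = S"
  proof (cases "transform m S = S")
    case True
    then show ?thesis
      by (intro bexI[of _ "[]"]) (auto simp: concise_def consistent_def)
  next
    case False
    then show ?thesis
      using med m(2) transform_closed[OF m(1,2)] unfolding medium_def by blast
  qed
  then obtain n where n: "n \<in> lists \<T>" "concise \<S> \<T> n (transform m S)"
    "transform n (transform m S) = S" by blast
  then have "return_for (m @ n) S"
    using m(3) by (simp add: return_for_def ineffective_def concise_def)
  then have "vacuous \<S> \<T> (m @ n)"
    using med m n(1) unfolding medium_def by (metis append_in_lists_conv)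
  with n that show ?thesis by blast
qed

text \<open>Apply \<open>\<tau>\<close> to a state it moves and close up: in the resulting vacuous
  message \<open>\<tau>\<close> is paired with a reverse.\<close>

lemma medium_M1:
  assumes "medium \<S> \<T>" and "\<tau> \<in> \<T>"
  shows "\<exists>\<tau>'. is_reverse \<S> \<T> \<tau>' \<tau>"
proof -
  obtain S where "S \<in> \<S>" "\<tau> S \<noteq> S"
    using token_moves_state assms(2) by blast
  then obtain n where "vacuous \<S> \<T> ([\<tau>] @ n)"
    using medium_closing[OF assms(1), of "[\<tau>]" S] assms(2) by auto
  then show ?thesis using vacuous_has_reverse by force
qed

lemma medium_vacuous_ineffective:
  assumes med: "medium \<S> \<T>" and m: "m \<in> lists \<T>" "S \<in> \<S>" "stepwise_effective m S"
    and vac: "vacuous \<S> \<T> m"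
  shows "ineffective m S"
proof -
  obtain n where n: "n \<in> lists \<T>" "concise \<S> \<T> n (transform m S)"
    "transform n (transform m S) = S" "vacuous \<S> \<T> (m @ n)"
    using medium_closing[OF med m] .
  have "n = []"
  proof (rule ccontr)
    assume "n \<noteq> []"
    then obtain \<tau> where \<tau>: "\<tau> \<in> set n" "\<tau> \<in> \<T>"
      using n(1) by (cases n) auto
    obtain \<tau>' where rev: "is_reverse \<S> \<T> \<tau>' \<tau>"
      using medium_M1[OF med \<tau>(2)] by blast
    \<comment> \<open>Both \<open>m @ n\<close> and \<open>m\<close> are balanced, and the counts in
      \<open>m\<close> cancel.\<close>
    have "count_list n \<tau> = count_list n \<tau>'"
      using vacuous_count_reverse[OF n(4) rev \<tau>(2)] vacuous_count_reverse[OF vac rev \<tau>(2)]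
      by simp
    then have "\<tau>' \<in> set n"
      using \<tau>(1) by (metis count_list_0_iff)
    then show False
      using n(2) \<tau>(1) rev unfolding concise_def consistent_def by blast
  qed
  then show ?thesis using n(3) by (simp add: ineffective_def)
qed

lemma medium_no_reverse_across:
  assumes med: "medium \<S> \<T>"
    and m: "m \<in> lists \<T>" "S \<in> \<S>" "stepwise_effective m S" "consistent \<S> \<T> m"
    and n: "n \<in> lists \<T>" "W \<in> \<S>" "stepwise_effective n W" "consistent \<S> \<T> n"
    and eq: "transform m S = transform n W"
    and in_sets: "\<tau> \<in> set m" "\<tau>' \<in> set n"
  shows "\<not> is_reverse \<S> \<T> \<tau>' \<tau>"
proof
  assume rev: "is_reverse \<S> \<T> \<tau>' \<tau>"
  have \<tau>: "\<tau> \<in> \<T>" "\<tau>' \<in> \<T>" using m(1) n(1) in_sets by auto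
  have rev': "is_reverse \<S> \<T> \<tau> \<tau>'" using is_reverse_sym[OF rev \<tau>(1)] .
  obtain a b where m_split: "m = a @ \<tau> # b"
    using in_sets(1) by (auto dest: split_list)
  obtain c d where n_split: "n = c @ \<tau>' # d"
    using in_sets(2) by (auto dest: split_list)
  \<comment> \<open>\<open>P\<close> is the state at which the chosen \<open>\<tau>\<close> acts in
    \<open>m\<close>, and \<open>Q\<close> the one at which \<open>\<tau>'\<close> acts in
    \<open>n\<close>.\<close>
  define P where "P = transform a S"
  define Q where "Q = transform c W"
  have PQ: "P \<in> \<S>" "Q \<in> \<S>"
    using transform_closed m(1,2) n(1,2) unfolding P_def Q_def m_split n_split by auto
  have b: "b \<in> lists \<T>" "stepwise_effective (\<tau> # b) P" "\<tau>' \<notin> set b"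
    using m rev unfolding P_def m_split consistent_def by auto
  have d: "\<tau>' # d \<in> lists \<T>" "stepwise_effective (\<tau>' # d) Q" "\<tau> \<notin> set (\<tau>' # d)"
    using n rev' unfolding Q_def n_split consistent_def by auto
  have meet: "transform (\<tau> # b) P = transform d (\<tau>' Q)"
    using eq unfolding P_def Q_def m_split n_split by simp
  have Q': "\<tau>' Q \<in> \<S>" "\<tau> (\<tau>' Q) = Q" "\<tau>' Q \<noteq> Q"
    using token_closed reverse_step[OF rev'] \<tau>(2) PQ(2) d(2) by auto
  \<comment> \<open>Only \<open>d\<close> is retraced, from the common final state back to just
    after \<open>\<tau>'\<close> acted. The one remaining step back to \<open>Q\<close> is
    \<open>\<tau>\<close> itself.\<close>
  obtain e where e: "e \<in> lists \<T>" "stepwise_effective e (transform d (\<tau>' Q))"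
    "transform e (transform d (\<tau>' Q)) = \<tau>' Q"
    "\<forall>\<sigma>\<in>set e. \<exists>\<rho>\<in>set d. is_reverse \<S> \<T> \<sigma> \<rho>"
    using inverse_message[OF medium_M1[OF med], of d "\<tau>' Q"] d Q'(1) by auto
  have not_e: "\<tau>' \<notin> set e"
  proof
    assume "\<tau>' \<in> set e"
    then obtain \<rho> where \<rho>: "\<rho> \<in> set d" "is_reverse \<S> \<T> \<tau>' \<rho>"
      using e(4) by blast
    then have "is_reverse \<S> \<T> \<rho> \<tau>'"
      using is_reverse_sym[OF \<rho>(2)] d(1) by auto
    then have "\<rho> = \<tau>" using reverse_unique rev' by blast
    then show False using \<rho>(1) d(3) by simp
  qed
  \<comment> \<open>The path runs from \<open>P\<close> forward along \<open>m\<close> to the common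
    state and back along \<open>n\<close> to \<open>Q\<close>. It begins and ends with
    \<open>\<tau>\<close>, while \<open>\<tau>'\<close> is absent from both \<open>b\<close> and
    \<open>e\<close>.\<close>
  define l where "l = \<tau> # b @ e @ [\<tau>]"
  have "l \<in> lists \<T>" "stepwise_effective l P"
    using b e \<tau>(1) meet Q' unfolding l_def by auto
  then obtain w where w: "concise \<S> \<T> w (transform l P)" "vacuous \<S> \<T> (l @ w)"
    using medium_closing[OF med _ PQ(1)] by blast
  have "\<tau> \<noteq> \<tau>'" using d(3) by auto
  then have "count_list l \<tau> \<ge> 2" "count_list l \<tau>' = 0"
    using b(3) not_e unfolding l_def by auto
  \<comment> \<open>A balanced \<open>l @ w\<close> would need at least two occurrences of
    \<open>\<tau>'\<close>, all of them in \<open>w\<close>.\<close>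
  moreover have "count_list w \<tau>' \<le> 1"
    using w(1) by (intro distinct_count_list) (simp add: concise_def)
  ultimately show False
    using vacuous_count_reverse[OF w(2) rev \<tau>(1)] by simp
qed

lemma medium_M4:
  assumes med: "medium \<S> \<T>"
    and m: "m \<in> lists \<T>" "S \<in> \<S>" "stepwise_effective m S" "consistent \<S> \<T> m"
    and n: "n \<in> lists \<T>" "W \<in> \<S>" "stepwise_effective n W" "consistent \<S> \<T> n"
    and eq: "transform m S = transform n W"
  shows "jointly_consistent \<S> \<T> m n"
  unfolding jointly_consistent_def consistent_def
proof
  assume "\<exists>\<sigma>\<in>set (m @ n). \<exists>\<tau>\<in>set (m @ n). is_reverse \<S> \<T> \<sigma> \<tau>"
  then obtain \<sigma> \<tau> where rev: "is_reverse \<S> \<T> \<sigma> \<tau>"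
    and sets: "\<sigma> \<in> set m \<union> set n" "\<tau> \<in> set m \<union> set n"
    by auto
  have "\<not> (\<sigma> \<in> set m \<and> \<tau> \<in> set m)" "\<not> (\<sigma> \<in> set n \<and> \<tau> \<in> set n)"
    using m(4) n(4) rev unfolding consistent_def by blast+
  \<comment> \<open>The offending pair must straddle the two messages; the second case exchanges
    their roles.\<close>
  with sets consider "\<tau> \<in> set m" "\<sigma> \<in> set n" | "\<tau> \<in> set n" "\<sigma> \<in> set m"
    by blast
  then show False
    using medium_no_reverse_across[OF med m n eq] rev
      medium_no_reverse_across[OF med n m eq[symmetric]]
    by cases simp_all
qed

section \<open>Conciseness from the four conditions\<close>

lemma distinct_of_M1_M4:
  assumes rev: "\<And>\<tau>. \<tau> \<in> \<T> \<Longrightarrow> \<exists>\<tau>'. is_reverse \<S> \<T> \<tau>' \<tau>"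
    and joint: "\<And>m n S W. m \<in> lists \<T> \<Longrightarrow> n \<in> lists \<T> \<Longrightarrow> S \<in> \<S> \<Longrightarrow> W \<in> \<S> \<Longrightarrow>
        stepwise_effective m S \<Longrightarrow> consistent \<S> \<T> m \<Longrightarrow>
        stepwise_effective n W \<Longrightarrow> consistent \<S> \<T> n \<Longrightarrow>
        transform m S = transform n W \<Longrightarrow> jointly_consistent \<S> \<T> m n"
    and m: "m \<in> lists \<T>" "S \<in> \<S>" "stepwise_effective m S" "consistent \<S> \<T> m"
  shows "distinct m"
  using m
proof (induction m rule: rev_induct)
  case Nil
  show ?case by simp
next
  case (snoc \<tau> m)
  have cons: "consistent \<S> \<T> m"
    using consistent_mono[OF snoc.prems(4)] by auto
  have \<tau>: "\<tau> \<in> \<T>" "\<not> is_reverse \<S> \<T> \<tau> \<tau>"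
    using snoc.prems(1,4) unfolding consistent_def by auto
  have R: "transform m S \<in> \<S>" "\<tau> (transform m S) \<noteq> transform m S"
    using transform_closed snoc.prems by auto
  obtain \<tau>' where \<tau>': "is_reverse \<S> \<T> \<tau>' \<tau>"
    using rev \<tau>(1) by blast
  have \<tau>'T: "\<tau>' \<in> \<T>" using \<tau>' unfolding is_reverse_def by blast
  \<comment> \<open>Were \<open>\<tau>'\<close> its own reverse, uniqueness would give
    \<open>\<tau>' = \<tau>\<close>, making \<open>\<tau>\<close> self-reverse. Hence
    \<open>[\<tau>']\<close> is consistent.\<close>
  have "\<not> is_reverse \<S> \<T> \<tau>' \<tau>'"
    using reverse_unique is_reverse_sym \<tau> \<tau>' by metis
  moreover have "\<tau>' (\<tau> (transform m S)) = transform m S"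
    using reverse_step \<tau>' \<tau>(1) R by blast
  \<comment> \<open>Started at the state reached by \<open>m @ [\<tau>]\<close>, the message
    \<open>[\<tau>']\<close> ends where \<open>m\<close> does, so [M4] applies.\<close>
  ultimately have "jointly_consistent \<S> \<T> m [\<tau>']"
    using joint[of m "[\<tau>']" S "\<tau> (transform m S)"] snoc.prems cons R \<tau>'T token_closed[OF \<tau>(1) R(1)]
    by (simp add: consistent_def)
  then have "\<tau> \<notin> set m"
    using \<tau>' unfolding jointly_consistent_def consistent_def by auto
  then show ?case using snoc cons by simp
qed

end

theorem theorem4:
  fixes \<S> :: "'s set" and \<T> :: "('s \<Rightarrow> 's) set"
  assumes "token_system \<S> \<T>"
  shows "medium \<S> \<T> \<longleftrightarrow>
     (\<forall>\<tau>\<in>\<T>. \<exists>\<tau>'. is_reverse \<S> \<T> \<tau>' \<tau>) \<and>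
     (\<forall>S\<in>\<S>. \<forall>V\<in>\<S>. S \<noteq> V \<longrightarrow>
        (\<exists>m\<in>lists \<T>. consistent \<S> \<T> m \<and> transform m S = V)) \<and>
     (\<forall>m\<in>lists \<T>. \<forall>S\<in>\<S>. stepwise_effective m S \<longrightarrow>
        (ineffective m S \<longleftrightarrow> vacuous \<S> \<T> m)) \<and>
     (\<forall>m\<in>lists \<T>. \<forall>n\<in>lists \<T>. \<forall>S\<in>\<S>. \<forall>W\<in>\<S>.
        stepwise_effective m S \<and> consistent \<S> \<T> m \<and>
        stepwise_effective n W \<and> consistent \<S> \<T> n \<and>
        transform m S = transform n W \<longrightarrow>
        jointly_consistent \<S> \<T> m n)"
    (is "_ \<longleftrightarrow> ?M1 \<and> ?M2 \<and> ?M3 \<and> ?M4")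
proof -
  interpret tokens \<S> \<T> by (rule tokens.intro) (rule assms)
  show ?thesis
  proof
    assume med: "medium \<S> \<T>"
    have ?M1 using medium_M1[OF med] by blast
    moreover have ?M2 using med unfolding medium_def concise_def by blast
    moreover have ?M3
    proof (intro ballI impI)
      fix m S assume m: "m \<in> lists \<T>" "S \<in> \<S>" "stepwise_effective m S"
      then have "ineffective m S \<Longrightarrow> vacuous \<S> \<T> m"
        using med by (auto simp: medium_def return_for_def)
      then show "ineffective m S \<longleftrightarrow> vacuous \<S> \<T> m"
        using medium_vacuous_ineffective[OF med m] by blast
    qed
    moreover have ?M4
      by (intro ballI impI) (elim conjE, rule medium_M4[OF med])
    ultimately show "?M1 \<and> ?M2 \<and> ?M3 \<and> ?M4" by blast
  next
    assume "?M1 \<and> ?M2 \<and> ?M3 \<and> ?M4"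
    then have M: ?M1 ?M2 ?M3 ?M4 by blast+
    have "\<exists>m\<in>lists \<T>. concise \<S> \<T> m S \<and> transform m S = V"
      if SV: "S \<in> \<S>" "V \<in> \<S>" "S \<noteq> V" for S V
    proof -
      obtain m where m: "m \<in> lists \<T>" "consistent \<S> \<T> m" "transform m S = V"
        using M(2) SV by blast
      \<comment> \<open>The message from [M2] may contain idle steps. Deleting them preserves
        consistency, because no new token enters.\<close>
      obtain n where n: "set n \<subseteq> set m" "stepwise_effective n S" "transform n S = V"
        using stepwise_effective_reduct m(3) by metis
      have "consistent \<S> \<T> n" using consistent_mono m(2) n(1) .
      moreover have nT: "n \<in> lists \<T>" using m(1) n(1) by auto
      moreover have "distinct n"
        using M(1,4) nT SV(1) n(2) \<open>consistent \<S> \<T> n\<close>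
        by (intro distinct_of_M1_M4) blast+
      ultimately show ?thesis using n(2,3) unfolding concise_def by blast
    qed
    \<comment> \<open>The constructed messages give [Ma]; [Mb] is one direction of [M3].\<close>
    then show "medium \<S> \<T>"
      using assms M(3) by (auto simp: medium_def return_for_def)
  qed
qed

end
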